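(* Let $A$ be a finite alphabet with $q=|A|\ge 1$ letters. Let $w,w_1,w_2$ be rich words over $A$ such that $w_1$ and $w_2$ are both factors of $w$, and let $m=\max\{|w_1|,|w_2|\}$, where $m\ge 1$. Then there exists a rich word $\bar w$ over $A$ such that $w_1$ and $w_2$ are both factors of $\bar w$ and $$|\bar w|\le m\,2^{k(m)+2},\qquad\text{where } k(m)=(q+1)\,m^2\,(4q^{10}m)^{\log_2 m}.$$
   Context: Words are finite words over $A$, including the empty word $\epsilon$; $|w|$ is the length of $w$. A factor of $w$ is a contiguous subword of $w$ (including $\epsilon$ and $w$ itself). A palindrome is a word equal to its reversal ($\epsilon$ is a palindrome). A word $w$ with $|w|=n$ has at most $n+1$ distinct palindromic factors (counting $\epsilon$); $w$ is called rich if it has exactly $n+1$ distinct palindromic factors. *)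

theory Defs
  imports Complex_Main "HOL-Library.Sublist"
begin

(* Words are lists; the factor relation (contiguous subword) is sublist. *)

definition palindrome :: "'a list \<Rightarrow> bool" where
  "palindrome w \<longleftrightarrow> rev w = w"

(* The set of palindromic factors always contains the empty word. *)
definition rich :: "'a list \<Rightarrow> bool" where
  "rich w \<longleftrightarrow> card {u. sublist u w \<and> palindrome u} = length w + 1"

(* Real-valued, since log 2 m is in general not an integer; used only for q, m \<ge> 1,
   where the base of powr is positive. *)
definition k_exponent :: "nat \<Rightarrow> nat \<Rightarrow> real" where
  "k_exponent q m =
     (real q + 1) * real m ^ 2 * (4 * real q ^ 10 * real m) powr (log 2 (real m))"

end

(* Only palindromes of length at most m matter. Read a rich word v containing both words from right
   to left: each letter creates one new palindrome, and a letter whose new palindrome is longer than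
   m creates no factor of length at most m that is new up to reversal. So a short copy u of v has to
   react only to the letters creating short palindromes. Before each of these, u is extended by
   palindromic closures, which create only palindromes longer than m, until it starts like v; this
   at most quadruples its length. A final closure provides both orientations of each factor.

   The same observation shows that the number of factors of length n up to reversal is at most the
   number of palindromes of length at most n. A palindrome is determined by its first half, so
   doubling n multiplies the number of palindromes of length at most n by at most 4n. *)
theory Submission
  imports Defs
begin


section \<open>Palindromic factors and the letterwise criterion for richness\<close>

definition pals :: "'a list \<Rightarrow> 'a list set" where
  "pals w = {u. sublist u w \<and> palindrome u}"

lemma finite_sublists: "finite {u. sublist u w}"
  by (metis List.finite_set set_sublists_eq)

lemma finite_pals: "finite (pals w)"
  unfolding pals_def by (rule finite_subset[OF _ finite_sublists[of w]]) auto

lemma pals_mono: "sublist v w \<Longrightarrow> pals v \<subseteq> pals w"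
  unfolding pals_def by (auto intro: sublist_order.order_trans)

lemma pals_rev: "pals (rev w) = pals w"
  unfolding pals_def palindrome_def by (auto simp: sublist_rev_right)

lemma rich_rev: "rich (rev w) \<longleftrightarrow> rich w"
  using pals_rev[of w] unfolding rich_def pals_def by simp

lemma palindrome_Nil: "palindrome []"
  by (simp add: palindrome_def)

lemma palindrome_prefix_suffix:
  assumes "palindrome p" "palindrome q" "prefix p q"
  shows "suffix p q"
  using assms unfolding palindrome_def by (metis suffix_to_prefix)

lemma palindrome_suffix_prefix:
  assumes "palindrome p" "palindrome q" "suffix p q"
  shows "prefix p q"
  using assms unfolding palindrome_def by (metis suffix_to_prefix)

text \<open>Being a palindromic prefix of the longer palindrome \<open>q\<close>, \<open>p\<close>
  is also a suffix of \<open>q\<close>, and that occurrence starts after the letter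
  \<open>x\<close>.\<close>

lemma shorter_palindrome_prefix_recurs:
  assumes "palindrome p" "palindrome q" "prefix p (x # v)" "prefix q (x # v)"
    "length p < length q"
  shows "sublist p v"
proof -
  have "prefix p q"
    using assms prefix_length_prefix[of p "x # v" q] by simp
  then have "suffix p q"
    using assms palindrome_prefix_suffix by blast
  then obtain z where z: "q = z @ p" by (elim suffixE)
  with assms(5) obtain y z' where "z = y # z'" by (cases z) auto
  then have "prefix (z' @ p) v" using assms(4) z by simp
  then show ?thesis
    by (metis prefix_imp_sublist sublist_append_leftI sublist_order.order_trans)
qed

text \<open>Of two palindromic prefixes of \<open>x # v\<close> the shorter one recurs in
  \<open>v\<close>, so \<open>x\<close> creates at most one new palindrome.\<close>

lemma pals_Cons:
  assumes "palindrome p" "prefix p (x # v)" "\<not> sublist p v"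
  shows "pals (x # v) = insert p (pals v)"
proof -
  have "u = p" if "prefix u (x # v)" "palindrome u" "\<not> sublist u v" for u
  proof -
    have "length u = length p"
      using shorter_palindrome_prefix_recurs[of u p x v]
        shorter_palindrome_prefix_recurs[of p u x v] that assms
      by (meson linorder_neqE_nat)
    then show ?thesis
      using that assms by (metis prefix_length_prefix order_refl prefix_order.antisym)
  qed
  then show ?thesis
    unfolding pals_def sublist_Cons_right using assms by blast
qed

lemma pals_Cons_no_new:
  assumes "\<And>p. palindrome p \<Longrightarrow> prefix p (x # v) \<Longrightarrow> sublist p v"
  shows "pals (x # v) = pals v"
  unfolding pals_def sublist_Cons_right using assms by blast

lemma card_pals_Cons: "card (pals (x # v)) \<le> Suc (card (pals v))"
  using pals_Cons[of _ x v] pals_Cons_no_new[of x v]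
  by (metis card_insert_le_m1 card_insert_if finite_pals le_Suc_eq order_refl)

lemma card_pals_le: "card (pals w) \<le> Suc (length w)"
proof (induction w)
  case Nil
  have "pals ([]::'a list) = {[]}" by (auto simp: pals_def palindrome_def)
  then show ?case by simp
next
  case (Cons x v)
  then show ?case using card_pals_Cons[of x v] by simp
qed

lemma rich_Nil: "rich []"
proof -
  have "{u::'a list. sublist u [] \<and> palindrome u} = {[]}" by (auto simp: palindrome_def)
  then show ?thesis by (simp add: rich_def)
qed

text \<open>Each letter creates at most one palindrome, so the maximal count is reached only if
  every letter creates one. This letterwise form drives the inductions below.\<close>

lemma rich_Cons_iff:
  "rich (x # v) \<longleftrightarrow> rich v \<and> (\<exists>p. palindrome p \<and> prefix p (x # v) \<and> \<not> sublist p v)"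
  (is "?L \<longleftrightarrow> ?R")
proof
  assume L: ?L
  then have c: "card (pals (x # v)) = Suc (Suc (length v))"
    by (simp add: rich_def pals_def)
  then have "pals (x # v) \<noteq> pals v" using card_pals_le[of v] by auto
  then have "\<exists>p. palindrome p \<and> prefix p (x # v) \<and> \<not> sublist p v"
    using pals_Cons_no_new[of x v] by blast
  moreover have "rich v"
    using c card_pals_Cons[of x v] card_pals_le[of v] by (simp add: rich_def pals_def)
  ultimately show ?R by blast
next
  assume ?R
  then obtain p where p: "rich v" "palindrome p" "prefix p (x # v)" "\<not> sublist p v"
    by blast
  then have "card (pals (x # v)) = Suc (card (pals v))"
    using pals_Cons[of p x v] finite_pals[of v] by (simp add: pals_def)
  then show ?L using p(1) by (simp add: rich_def pals_def)
qed

lemma rich_snoc_iff: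
  "rich (v @ [x]) \<longleftrightarrow> rich v \<and> (\<exists>p. palindrome p \<and> suffix p (v @ [x]) \<and> \<not> sublist p v)"
proof -
  have "rich (v @ [x]) \<longleftrightarrow> rich (x # rev v)"
    using rich_rev[of "v @ [x]"] by simp
  also have "\<dots> \<longleftrightarrow> rich v \<and> (\<exists>p. palindrome p \<and> prefix p (x # rev v) \<and> \<not> sublist p (rev v))"
    by (simp add: rich_Cons_iff rich_rev)
  also have "(\<exists>p. palindrome p \<and> prefix p (x # rev v) \<and> \<not> sublist p (rev v)) \<longleftrightarrow>
     (\<exists>p. palindrome p \<and> suffix p (v @ [x]) \<and> \<not> sublist p v)"
    unfolding palindrome_def suffix_to_prefix[of _ "v @ [x]"]
    by (auto simp: sublist_rev_right)
  finally show ?thesis .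
qed

section \<open>Factors of rich words and palindromic returns\<close>

lemma rich_append_right: "rich (a @ b) \<Longrightarrow> rich b"
  by (induction a) (auto simp: rich_Cons_iff)

lemma rich_append_left: "rich (a @ b) \<Longrightarrow> rich a"
  using rich_append_right[of "rev b" "rev a"] rich_rev[of "a @ b"] rich_rev[of a] by simp

lemma rich_sublist: "rich w \<Longrightarrow> sublist v w \<Longrightarrow> rich v"
  unfolding sublist_def using rich_append_left rich_append_right by blast

text \<open>A shortest prefix longer than \<open>u\<close> that ends in \<open>u\<close> or \<open>rev u\<close> is a palindrome, because
  its new palindromic suffix cannot be shorter than the whole prefix.\<close>
lemma palindromic_return:
  assumes "rich E" "prefix u E" "length u < length E" "suffix u E \<or> suffix (rev u) E"
  shows "\<exists>F. prefix F E \<and> palindrome F \<and> length u < length F"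
  using assms
proof (induction "length E" arbitrary: E rule: less_induct)
  case less
  obtain E' y where E: "E = E' @ [y]"
    using less.prems(3) by (cases E rule: rev_cases) auto
  obtain L where L: "palindrome L" "suffix L E" "\<not> sublist L E'"
    using less.prems(1) unfolding E rich_snoc_iff by blast
  have uE': "prefix u E'" using less.prems(2,3) E by auto
  \<comment> \<open>A palindrome \<open>L\<close> no longer than \<open>u\<close> would be a suffix
    of \<open>u\<close> or \<open>rev u\<close>, hence a factor of \<open>u\<close> and of
    \<open>E'\<close>, against its newness.\<close>
  have long: "length u < length L"
  proof (rule ccontr)
    assume "\<not> length u < length L"
    then have "suffix L u \<or> suffix L (rev u)"
      using less.prems(4) L(2)
      by (metis suffix_length_suffix length_rev not_less)
    then have "sublist L u"
      using L(1) unfolding palindrome_def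
      by (metis suffix_imp_sublist sublist_rev)
    then show False
      using uE' L(3) by (meson prefix_imp_sublist sublist_order.order_trans)
  qed
  obtain t where t: "E = t @ L" using L(2) by (elim suffixE)
  show ?case
  proof (cases t)
    case Nil
    then show ?thesis using t L long by auto
  next
    case (Cons c t')
    have sfx: "suffix u L \<or> suffix (rev u) L"
      using less.prems(4) L(2) long
      by (metis length_rev less_imp_le suffix_length_suffix)
    then have pre: "prefix (rev u) L \<or> prefix u L"
      using L(1) unfolding palindrome_def by (metis suffix_to_prefix rev_rev_ident)
    \<comment> \<open>The occurrence at the end of \<open>L\<close> is mirrored to the beginning of
      \<open>L\<close>; cutting \<open>E\<close> after the mirror image gives a shorter
      instance.\<close>
    define E1 where "E1 = t @ take (length u) L"
    have tk: "take (length u) L = rev u \<or> take (length u) L = u"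
      using pre unfolding prefix_def by auto
    have p1: "prefix E1 E"
      unfolding E1_def t by (simp add: take_is_prefix)
    have lu: "length E1 = length t + length u"
      unfolding E1_def using long by simp
    have "\<exists>F. prefix F E1 \<and> palindrome F \<and> length u < length F"
    proof (rule less.hyps)
      show "length E1 < length E" using lu t long by simp
      show "rich E1" using less.prems(1) p1 rich_sublist by blast
      show "prefix u E1"
        using p1 less.prems(2) lu by (metis prefix_length_prefix le_add2)
      show "length u < length E1" using lu Cons by simp
      show "suffix u E1 \<or> suffix (rev u) E1"
        using tk unfolding E1_def by (auto simp: suffix_def)
    qed
    then show ?thesis using p1 prefix_order.order_trans by blast
  qed
qed

section \<open>Palindromic closure\<close>

text \<open>The prefix has to be proper so that closing lengthens even a word that is already a
  palindrome.\<close>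

definition longest_proper_palindrome_prefix :: "'a list \<Rightarrow> 'a list \<Rightarrow> bool" where
  "longest_proper_palindrome_prefix s w \<longleftrightarrow> palindrome s \<and> strict_prefix s w \<and>
     (\<forall>t. palindrome t \<longrightarrow> strict_prefix t w \<longrightarrow> length t \<le> length s)"

lemma longest_proper_palindrome_prefix_exists:
  assumes "w \<noteq> []"
  shows "\<exists>s. longest_proper_palindrome_prefix s w"
proof -
  let ?P = "\<lambda>t. palindrome t \<and> strict_prefix t w"
  have "?P []" using assms by (cases w) (auto simp: palindrome_Nil)
  moreover have "\<forall>t. ?P t \<longrightarrow> length t < length w"
    by (auto dest: prefix_length_less)
  ultimately have "\<exists>s. ?P s \<and> (\<forall>t. ?P t \<longrightarrow> length t \<le> length s)"
    by (rule ex_has_greatest_nat)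
  then show ?thesis unfolding longest_proper_palindrome_prefix_def by blast
qed

text \<open>Another occurrence would yield a proper palindromic prefix of \<open>s @ a @ x # b\<close> longer than
  \<open>s\<close>: by stripping its two ends if it starts among the added letters, and by
  \<open>palindromic_return\<close> otherwise.\<close>
lemma palindromic_extension_new:
  assumes "rich (s @ a @ x # b)" "longest_proper_palindrome_prefix s (s @ a @ x # b)"
  shows "\<not> sublist (x # rev a @ s @ a @ [x]) (rev a @ s @ a @ x # b)"
proof
  let ?w = "s @ a @ x # b"
  let ?u = "s @ a @ [x]"
  let ?P = "x # rev a @ s @ a @ [x]"
  have ps: "rev s = s"
    and max: "\<And>t. rev t = t \<Longrightarrow> strict_prefix t ?w \<Longrightarrow> length t \<le> length s"
    using assms(2) unfolding longest_proper_palindrome_prefix_def palindrome_def by auto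
  have palP: "rev ?P = ?P" using ps by simp
  assume "sublist ?P (rev a @ ?w)"
  then obtain p t where pt: "rev a @ ?w = p @ ?P @ t" unfolding sublist_def by auto
  then consider (inside) c where "rev a = p @ c" "c \<noteq> []" "c @ ?w = ?P @ t"
    | (right) c where "p = rev a @ c" "?w = c @ ?P @ t"
    unfolding append_eq_append_conv2[of "rev a"]
    by (metis append_Nil append_Nil2)
  then show False
  proof cases
    case inside
    have "length c \<le> length a" using inside(1)
      by (metis length_append length_rev le_add2)
    have "prefix c ?P"
    proof (rule prefix_length_prefix)
      show "prefix c (c @ ?w)" by simp
      show "prefix ?P (c @ ?w)" using inside(3) by (rule prefixI)
      show "length c \<le> length ?P" using \<open>length c \<le> length a\<close> by simp
    qed
    \<comment> \<open>Here \<open>c\<close> is the part of the occurrence inside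
      \<open>rev a\<close>. Removing \<open>c\<close> and its mirror image from the ends of
      \<open>?P\<close> leaves a palindromic prefix \<open>Q\<close> of \<open>?w\<close>, still
      longer than \<open>s\<close> because \<open>c\<close> is no longer than
      \<open>a\<close>.\<close>
    then obtain R where R: "?P = c @ R" by (elim prefixE)
    have "suffix (rev c) R"
    proof (rule suffix_length_suffix)
      show "suffix (rev c) ?P" using \<open>prefix c ?P\<close> palP
        by (metis suffix_to_prefix rev_rev_ident)
      show "suffix R ?P" using R by (simp add: suffix_def)
      show "length (rev c) \<le> length R"
        using arg_cong[OF R, of length] \<open>length c \<le> length a\<close> by simp
    qed
    then obtain Q where Q: "R = Q @ rev c" by (elim suffixE)
    have "rev Q = Q" using palP unfolding R Q by simp
    moreover have "strict_prefix Q ?w"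
    proof -
      have "?w = Q @ rev c @ t" using inside(3) unfolding R Q by simp
      moreover have "rev c @ t \<noteq> []" using inside(2) by simp
      ultimately show ?thesis by (metis prefixI same_append_eq append_Nil2 strict_prefixI)
    qed
    moreover have "length s < length Q"
      using arg_cong[OF R[unfolded Q], of length] \<open>length c \<le> length a\<close> by simp
    ultimately show False using max by fastforce
  next
    case right
    have less: "length (c @ rev ?u) < length ?w"
      using arg_cong[OF right(2), of length] by simp
    show False
    \<comment> \<open>\<open>?P\<close> starts with \<open>rev ?u\<close>. If it occurs at the very
      beginning of \<open>?w\<close>, then \<open>?u\<close> itself is a palindrome; otherwise
      \<open>?w\<close> has a prefix that starts with \<open>?u\<close> and ends in
      \<open>rev ?u\<close>.\<close>
    proof (cases "c = []")
      case True
      have "prefix (rev ?u) ?w" using right(2) ps True by (auto intro: prefixI)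
      moreover have "prefix ?u ?w" by (auto intro: prefixI)
      ultimately have "rev ?u = ?u"
        by (metis length_rev order_refl prefix_length_prefix prefix_order.antisym)
      moreover have "strict_prefix ?u ?w"
        using less \<open>prefix ?u ?w\<close> by (auto intro!: strict_prefixI simp: True)
      ultimately show False using max[of ?u] by simp
    next
      case False
      let ?E = "c @ rev ?u"
      have pE: "prefix ?E ?w" using right(2) ps by (auto intro: prefixI)
      have "\<exists>F. prefix F ?E \<and> palindrome F \<and> length ?u < length F"
      proof (rule palindromic_return)
        show "rich ?E" using assms(1) pE rich_sublist by blast
        show "prefix ?u ?E"
          by (rule prefix_length_prefix[of _ ?w, OF _ pE]) (auto intro: prefixI)
        show "length ?u < length ?E" using False by simp
        show "suffix ?u ?E \<or> suffix (rev ?u) ?E" by (auto simp: suffix_def)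
      qed
      then obtain F where F: "prefix F ?E" "palindrome F" "length ?u < length F" by blast
      have "strict_prefix F ?w"
        using F(1) pE less by (metis prefix_length_le not_less prefix_order.trans strict_prefixI)
      then show False using max[of F] F unfolding palindrome_def by simp
    qed
  qed
qed

text \<open>Each prepended letter completes a palindrome centred at \<open>s\<close>, of length at
  least \<open>length s + 2\<close>, which is new by \<open>palindromic_extension_new\<close>.
  Richness therefore persists and no other palindromes arise.\<close>

lemma rich_palindromic_extension:
  assumes "rich (s @ a @ b)" "longest_proper_palindrome_prefix s (s @ a @ b)"
  shows "rich (rev a @ s @ a @ b) \<and>
    pals (rev a @ s @ a @ b) \<subseteq> pals (s @ a @ b) \<union> {p. length s + 2 \<le> length p}"
  using assms
\<comment> \<open>The last letter of \<open>a\<close> is prepended last; for the induction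
  hypothesis it is moved into \<open>b\<close>.\<close>
proof (induction a arbitrary: b rule: rev_induct)
  case Nil
  then show ?case by simp
next
  case (snoc x a)
  let ?P = "x # rev a @ s @ a @ [x]"
  have IH: "rich (rev a @ s @ a @ x # b)"
    "pals (rev a @ s @ a @ x # b) \<subseteq> pals (s @ a @ x # b) \<union> {p. length s + 2 \<le> length p}"
    using snoc.IH[of "x # b"] snoc.prems by simp_all
  have new: "\<not> sublist ?P (rev a @ s @ a @ x # b)"
    using palindromic_extension_new[of s a x b] snoc.prems by simp
  have pal: "palindrome ?P"
    using snoc.prems(2)
    by (simp add: longest_proper_palindrome_prefix_def palindrome_def)
  have pre: "prefix ?P (x # rev a @ s @ a @ x # b)" by (auto intro: prefixI)
  have "rich (x # rev a @ s @ a @ x # b)"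
    using IH(1) new pal pre by (intro rich_Cons_iff[THEN iffD2] conjI exI[of _ ?P])
  moreover have "pals (x # rev a @ s @ a @ x # b) = insert ?P (pals (rev a @ s @ a @ x # b))"
    using pal pre new by (rule pals_Cons)
  moreover have "length s + 2 \<le> length ?P" by simp
  ultimately show ?case using IH(2) by simp
qed


text \<open>The letter to prepend is the one following the longest proper palindromic
  prefix.\<close>

lemma rich_extend_left:
  assumes "rich v" "v \<noteq> []"
  shows "\<exists>x \<in> set v. rich (x # v)"
proof -
  obtain s where s: "longest_proper_palindrome_prefix s v"
    using longest_proper_palindrome_prefix_exists[OF assms(2)] by blast
  then have "strict_prefix s v"
    by (simp add: longest_proper_palindrome_prefix_def)
  then obtain y b where v: "v = s @ y # b" by (elim strict_prefixE')
  have "rich (rev [y] @ s @ [y] @ b)"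
    using rich_palindromic_extension[of s "[y]" b] assms(1) s v by simp
  then show ?thesis using v by (intro bexI[of _ y]) auto
qed

text \<open>\<open>p\<close> and \<open>t\<close> guarantee that the centre \<open>s\<close> has
  length at least \<open>n\<close>: if \<open>p\<close> is all of \<open>u\<close>, then
  \<open>u\<close> is a palindrome and its suffix \<open>t\<close> is a proper palindromic prefix.
  Partial closures \<open>rev a @ u\<close> are included because a closure may have to stop
  midway.\<close>

lemma rich_palindromic_closure:
  assumes "rich u" "palindrome p" "prefix p u" "n \<le> length p"
    "palindrome t" "suffix t u" "length t < length u" "n \<le> length t"
  obtains s r where "u = s @ r" "palindrome s" "r \<noteq> []" "n \<le> length s"
    "palindrome (rev r @ u)"
    "\<And>a b. r = a @ b \<Longrightarrow> rich (rev a @ u)"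
    "\<And>a b. r = a @ b \<Longrightarrow> pals (rev a @ u) \<subseteq> pals u \<union> {p. n + 2 \<le> length p}"
proof -
  have "u \<noteq> []" using assms(7) by auto
  then obtain s where s: "longest_proper_palindrome_prefix s u"
    using longest_proper_palindrome_prefix_exists by blast
  then have ps: "palindrome s" and "strict_prefix s u"
    and max: "\<And>q. palindrome q \<Longrightarrow> strict_prefix q u \<Longrightarrow> length q \<le> length s"
    by (auto simp: longest_proper_palindrome_prefix_def)
  then obtain y b where "u = s @ y # b" by (elim strict_prefixE')
  then obtain r where u: "u = s @ r" and r: "r \<noteq> []" by blast
  have n: "n \<le> length s"
  proof (cases "p = u")
    case True
    then have "prefix t u" using palindrome_suffix_prefix assms by metis
    then have "strict_prefix t u" using assms(7) by (auto intro: strict_prefixI)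
    then show ?thesis using max[OF assms(5)] assms(8) by simp
  next
    case False
    then have "strict_prefix p u" using assms(3) by (simp add: strict_prefixI)
    then show ?thesis using max[OF assms(2)] assms(4) by simp
  qed
  have ext: "rich (rev a @ u)"
    "pals (rev a @ u) \<subseteq> pals u \<union> {p. n + 2 \<le> length p}" if "r = a @ b" for a b
  proof -
    have "rich (rev a @ u) \<and> pals (rev a @ u) \<subseteq> pals u \<union> {p. length s + 2 \<le> length p}"
      using rich_palindromic_extension[of s a b] s assms(1) unfolding u that by simp
    moreover have "{p :: 'a list. length s + 2 \<le> length p} \<subseteq> {p. n + 2 \<le> length p}"
      using n by auto
    ultimately show "rich (rev a @ u)"
      "pals (rev a @ u) \<subseteq> pals u \<union> {p. n + 2 \<le> length p}" by simp_all blast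
  qed
  have "palindrome (rev r @ u)" using ps unfolding u palindrome_def by simp
  then show thesis using that[of s r] u ps r n ext by simp
qed

text \<open>After one closure the word is a palindrome \<open>U = s' @ r' = rev r' @ s'\<close>, so it has period
  \<open>length r'\<close>, and \<open>f\<close> occurs in it at a position at most \<open>length r'\<close>; a second closure
  then prepends the letters that are missing to the left of that occurrence.\<close>
lemma rich_extend_to_prefix:
  assumes "rich u" "palindrome p" "prefix p u" "n \<le> length p"
    "palindrome t" "suffix t u" "length t < length u" "n \<le> length t" "1 \<le> n"
    "sublist f u \<or> sublist (rev f) u"
  shows "\<exists>a. rich (a @ u) \<and> prefix f (a @ u) \<and> set a \<subseteq> set u \<and>
    pals (a @ u) \<subseteq> pals u \<union> {p. n + 2 \<le> length p} \<and> length (a @ u) < 4 * length u"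
proof -
  obtain s r where sr: "u = s @ r" "palindrome s" "n \<le> length s" "palindrome (rev r @ u)"
    "rich (rev r @ u)" "pals (rev r @ u) \<subseteq> pals u \<union> {p. n + 2 \<le> length p}"
    using rich_palindromic_closure[OF assms(1-8)] by (metis append_Nil2)
  define U where "U = rev r @ u"
  have U: "rich U" "palindrome U" "pals U \<subseteq> pals u \<union> {p. n + 2 \<le> length p}"
    using sr by (auto simp: U_def)
  have tU: "suffix t U" "length t < length U" "n \<le> length U"
    using assms(6,7,8) by (auto simp: U_def suffix_appendI)
  obtain s' r' where sr': "U = s' @ r'" "palindrome s'" "r' \<noteq> []" "n \<le> length s'"
    "\<And>a b. r' = a @ b \<Longrightarrow> rich (rev a @ U)"
    "\<And>a b. r' = a @ b \<Longrightarrow> pals (rev a @ U) \<subseteq> pals U \<union> {p. n + 2 \<le> length p}"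
    using rich_palindromic_closure[OF U(1,2) prefix_order.refl tU(3) assms(5) tU(1,2) assms(8)]
    by metis
  have U': "U = rev r' @ s'"
    using U(2) sr'(1,2) unfolding palindrome_def by (metis rev_append)
  have "sublist f U"
  proof -
    have "sublist u U" by (auto simp: U_def)
    then have "sublist f U \<or> sublist (rev f) U"
      using assms(10) sublist_order.order_trans by blast
    then show ?thesis
      using U(2) unfolding palindrome_def by (metis sublist_rev)
  qed
  then have ex: "\<exists>k c g. U = c @ f @ g \<and> length c = k" by (auto simp: sublist_def)
  define k where "k = (LEAST k. \<exists>c g. U = c @ f @ g \<and> length c = k)"
  obtain c g where c: "U = c @ f @ g" "length c = k"
    using LeastI_ex[OF ex] unfolding k_def by blast
  have least: "k \<le> length c'" if "U = c' @ f @ g'" for c' g'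
    unfolding k_def by (rule Least_le) (use that in blast)
  have "length c \<le> length r'"
  proof (rule ccontr)
    assume "\<not> length c \<le> length r'"
    then have "prefix (rev r') c"
      using c(1) U' by (metis length_rev nat_le_linear prefixI prefix_length_prefix)
    then obtain c' where c': "c = rev r' @ c'" by (elim prefixE)
    then have "s' = c' @ f @ g" using c(1) U' by simp
    then have "U = c' @ f @ (g @ r')" using sr'(1) by simp
    from least[OF this] show False using c(2) c' sr'(3) by (cases r') simp_all
  qed
  then have "prefix c (rev r')"
    using c(1) U' by (metis length_rev prefixI prefix_length_prefix)
  \<comment> \<open>\<open>e\<close> is the part of \<open>rev r'\<close> to the right of where
    \<open>f\<close> starts. Stopping the second closure after prepending \<open>e\<close> puts
    \<open>f\<close> at the front, since \<open>f @ g = e @ s'\<close>.\<close>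
  then obtain e where e: "rev r' = c @ e" by (elim prefixE)
  then have r': "r' = rev e @ rev c" by (metis rev_append rev_rev_ident)
  have "f @ g = e @ s'" using c(1) U' e by simp
  then have "e @ U = f @ g @ r'" using sr'(1) by simp
  then have pre: "prefix f (e @ U)" by (auto intro: prefixI)
  \<comment> \<open>\<open>1 \<le> n\<close> makes \<open>s\<close> and \<open>s'\<close> nonempty,
    so each closure less than doubles the length.\<close>
  have len: "length (e @ U) < 4 * length u"
  proof -
    have "length e \<le> length r'" unfolding r' by simp
    moreover have "length U = length s' + length r'" using sr'(1) by simp
    moreover have "length U = length r + length u" "length u = length s + length r"
      using sr(1) by (auto simp: U_def)
    ultimately show ?thesis using sr(3) sr'(4) assms(9) by simp
  qed
  have "set e \<subseteq> set (rev r')" using e by simp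
  also have "\<dots> \<subseteq> set U" using sr'(1) by simp
  also have "\<dots> \<subseteq> set u" using sr(1) by (auto simp: U_def)
  finally have "set (e @ rev r) \<subseteq> set u" using sr(1) by auto
  moreover have "rich (e @ U)" using sr'(5)[OF r'] by simp
  moreover have "pals (e @ U) \<subseteq> pals u \<union> {p. n + 2 \<le> length p}"
    using sr'(6)[OF r'] U(3) by auto
  ultimately show ?thesis
    using pre len by (intro exI[of _ "e @ rev r"]) (simp add: U_def)
qed

section \<open>Short palindromes and factors up to reversal\<close>

definition short_pals :: "nat \<Rightarrow> 'a list \<Rightarrow> 'a list set" where
  "short_pals n w = {p \<in> pals w. length p \<le> n}"

lemma finite_short_pals: "finite (short_pals n w)"
  unfolding short_pals_def by (rule finite_subset[OF _ finite_pals]) auto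

lemma short_pals_mono: "sublist v w \<Longrightarrow> short_pals n v \<subseteq> short_pals n w"
  unfolding short_pals_def using pals_mono[of v w] by blast

lemma card_short_pals_mono: "sublist v w \<Longrightarrow> card (short_pals n v) \<le> card (short_pals n w)"
  by (intro card_mono finite_short_pals short_pals_mono)

lemma short_pals_Cons:
  assumes "palindrome p" "prefix p (x # v)" "\<not> sublist p v" "length p \<le> n"
  shows "short_pals n (x # v) = insert p (short_pals n v)"
  using pals_Cons[OF assms(1-3)] assms(4) unfolding short_pals_def by auto

lemma card_short_pals_Cons:
  assumes "palindrome p" "prefix p (x # v)" "\<not> sublist p v" "length p \<le> n"
  shows "card (short_pals n (x # v)) = Suc (card (short_pals n v))"
  using short_pals_Cons[OF assms] finite_short_pals[of n v] assms(3)
  by (simp add: short_pals_def pals_def)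

text \<open>Mirroring an occurrence inside a palindrome reverses it, so the construction can follow
  factors only up to reversal.\<close>

definition sublist_up_to_rev :: "'a list \<Rightarrow> 'a list \<Rightarrow> bool" where
  "sublist_up_to_rev f u \<longleftrightarrow> sublist f u \<or> sublist (rev f) u"

lemma sublist_up_to_rev_trans:
  "sublist_up_to_rev f u \<Longrightarrow> sublist u v \<Longrightarrow> sublist_up_to_rev f v"
  unfolding sublist_up_to_rev_def by (metis sublist_order.order_trans)

lemma sublist_up_to_rev_rev: "sublist_up_to_rev (rev f) u \<longleftrightarrow> sublist_up_to_rev f u"
  unfolding sublist_up_to_rev_def by auto

section \<open>Copying a rich word into a short one\<close>

text \<open>The mirror image of \<open>f\<close> at the end of \<open>p\<close> starts after
  \<open>x\<close>, since \<open>f\<close> is shorter than \<open>p\<close>. So a letter that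
  creates a long palindrome creates no shorter factor that is new up to reversal.\<close>

lemma prefix_of_long_new_palindrome:
  assumes "palindrome p" "prefix p (x # v)" "prefix f (x # v)" "length f < length p"
  shows "sublist (rev f) v"
proof -
  have "prefix f p" using assms(2-4) prefix_length_prefix[of f "x # v" p] by simp
  then have "suffix (rev f) p"
    using assms(1) unfolding palindrome_def by (metis suffix_to_prefix rev_rev_ident)
  then obtain z where z: "p = z @ rev f" by (elim suffixE)
  with assms(4) obtain y z' where "z = y # z'" by (cases z) auto
  then have "prefix (z' @ rev f) v" using assms(2) z by simp
  then show ?thesis
    by (metis prefix_imp_sublist sublist_append_leftI sublist_order.order_trans)
qed

lemma prefix_take_cong:
  assumes "prefix q v" "length q \<le> n" "take n u = take n v"
  shows "prefix q u"
proof -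
  obtain z where "v = q @ z" using assms(1) by (elim prefixE)
  then have "take n u = q @ take (n - length q) z" using assms(2,3) by simp
  then have "u = q @ take (n - length q) z @ drop n u"
    by (metis append_assoc append_take_drop_id)
  then show ?thesis by (rule prefixI)
qed

lemma palindrome_strip:
  assumes "palindrome p" "2 \<le> length p"
  obtains x q where "p = x # q @ [x]" "palindrome q"
proof -
  obtain x p' where p: "p = x # p'" using assms(2) by (cases p) auto
  then obtain q y where p': "p' = q @ [y]" using assms(2) by (cases p' rule: rev_cases) auto
  have "y # rev q @ [x] = x # q @ [y]"
    using assms(1)[unfolded palindrome_def p p'] by (simp only: rev.simps rev_append append.simps append_assoc)
  then have yx: "y = x" and "rev q @ [x] = q @ [y]" by (simp_all only: list.inject)
  then have "rev q = q" by (simp only: append1_eq_conv)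
  then have "p = x # q @ [x]" "palindrome q"
    unfolding p p' yx palindrome_def by simp_all
  then show thesis by (rule that)
qed


text \<open>The last conjunct is the invariant that allows the next letter creating a short palindrome to
  be copied: either \<open>u\<close> has a palindromic prefix of length at least \<open>M - 1\<close>, so that its closures
  create no short palindrome, or \<open>u\<close> still starts like the original word. When a letter creates a
  palindrome longer than \<open>M\<close>, stripping its two ends leads from the second case to the first.\<close>
lemma short_factors_in_small_rich_word:
  assumes "rich (a @ u0)" "2 \<le> M" "M \<le> length u0"
    "palindrome t" "suffix t u0" "length t < length u0" "M - 1 \<le> length t"
  shows "\<exists>u. rich u \<and> suffix u0 u \<and> set u \<subseteq> set (a @ u0) \<and>
    (\<forall>f. length f \<le> M \<longrightarrow> sublist f (a @ u0) \<longrightarrow> sublist_up_to_rev f u) \<and>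
    short_pals M u \<subseteq> short_pals M (a @ u0) \<and>
    length u \<le> length u0 * 4 ^ card (short_pals M (a @ u0)) \<and>
    ((\<exists>p. palindrome p \<and> prefix p u \<and> M - 1 \<le> length p) \<or>
     (take M u = take M (a @ u0) \<and>
      (\<forall>p. palindrome p \<longrightarrow> prefix p (a @ u0) \<longrightarrow> length p \<le> M)))"
  using assms(1)
proof (induction a)
  case Nil
  have "length u0 \<le> length u0 * 4 ^ card (short_pals M u0)" by simp
  moreover have "(\<exists>p. palindrome p \<and> prefix p u0 \<and> M - 1 \<le> length p) \<or>
      (\<forall>p. palindrome p \<longrightarrow> prefix p u0 \<longrightarrow> length p \<le> M)"
    by (meson diff_le_self le_trans nat_le_linear)
  ultimately show ?case
    using Nil by (intro exI[of _ u0]) (simp add: sublist_up_to_rev_def)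
next
  case (Cons x a)
  let ?v = "a @ u0"
  let ?N = "\<lambda>w :: 'a list. card (short_pals M w)"
  from Cons.prems obtain p where rv: "rich ?v"
    and p: "palindrome p" "prefix p (x # ?v)" "\<not> sublist p ?v"
    by (auto simp: rich_Cons_iff)
  from Cons.IH[OF rv] obtain u where u: "rich u" "suffix u0 u" "set u \<subseteq> set ?v"
      "\<And>f. length f \<le> M \<Longrightarrow> sublist f ?v \<Longrightarrow> sublist_up_to_rev f u"
      "short_pals M u \<subseteq> short_pals M ?v"
      "length u \<le> length u0 * 4 ^ ?N ?v"
    and state: "(\<exists>p. palindrome p \<and> prefix p u \<and> M - 1 \<le> length p) \<or>
     (take M u = take M ?v \<and> (\<forall>p. palindrome p \<longrightarrow> prefix p ?v \<longrightarrow> length p \<le> M))"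
    by blast
  have sub: "sublist ?v (x # ?v)" by (simp add: suffix_ConsI suffix_imp_sublist)
  show ?case
  proof (cases "length p \<le> M")
    case False
    have fac: "sublist_up_to_rev f u" if "length f \<le> M" "sublist f (x # ?v)" for f
    proof -
      have "sublist f ?v \<or> sublist (rev f) ?v"
        using that False prefix_of_long_new_palindrome[OF p(1,2), of f]
        by (auto simp: sublist_Cons_right)
      then show ?thesis
        using u(4)[of f] u(4)[of "rev f"] that(1) sublist_up_to_rev_rev[of f u] by auto
    qed
    obtain y q where q: "p = y # q @ [y]" "palindrome q"
      using palindrome_strip[OF p(1)] False assms(2) by auto
    have "prefix (q @ [y]) ?v" using p(2) q(1) by auto
    then have pq: "prefix q ?v" by (rule append_prefixD)
    have lq: "M - 1 \<le> length q" using False q(1) by simp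
    have st: "\<exists>p. palindrome p \<and> prefix p u \<and> M - 1 \<le> length p"
      using state
    proof
      assume s: "take M u = take M ?v \<and> (\<forall>p. palindrome p \<longrightarrow> prefix p ?v \<longrightarrow> length p \<le> M)"
      then have "length q \<le> M" using q(2) pq by blast
      then have "prefix q u" using prefix_take_cong[OF pq] s by blast
      then show ?thesis using q(2) lq by blast
    qed
    have "length u \<le> length u0 * 4 ^ ?N (x # ?v)"
    proof -
      have "(4::nat) ^ ?N ?v \<le> 4 ^ ?N (x # ?v)"
        using card_short_pals_mono[OF sub] by (intro power_increasing) auto
      then show ?thesis using u(6) by (meson le_trans mult_le_mono2)
    qed
    moreover have "short_pals M u \<subseteq> short_pals M (x # ?v)"
      using u(5) short_pals_mono[OF sub] by (rule subset_trans)
    moreover have "set u \<subseteq> set (x # ?v)" using u(3) by auto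
    ultimately have "rich u \<and> suffix u0 u \<and> set u \<subseteq> set ((x # a) @ u0) \<and>
      (\<forall>f. length f \<le> M \<longrightarrow> sublist f ((x # a) @ u0) \<longrightarrow> sublist_up_to_rev f u) \<and>
      short_pals M u \<subseteq> short_pals M ((x # a) @ u0) \<and>
      length u \<le> length u0 * 4 ^ ?N ((x # a) @ u0)"
      using u(1,2) fac by simp
    then show ?thesis using st by (intro exI[of _ u]) simp
  next
    case True
    have ne: "length u0 \<le> length u" using u(2) by (metis suffix_length_le)
    \<comment> \<open>Before \<open>x\<close> can be copied, the word must start like
      \<open>?v\<close>. In the second state \<open>u\<close> already does.\<close>
    have "\<exists>u'. rich u' \<and> suffix u u' \<and> set u' \<subseteq> set u \<and> take M u' = take M ?v \<and>
       short_pals M u' \<subseteq> short_pals M u \<and> length u' < 4 * length u"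
      using state
    proof
      assume "\<exists>p. palindrome p \<and> prefix p u \<and> M - 1 \<le> length p"
      then obtain q where q: "palindrome q" "prefix q u" "M - 1 \<le> length q" by blast
      have tu: "suffix t u" "length t < length u"
        using assms(5,6) u(2) ne by (auto intro: suffix_order.trans)
      have M: "1 \<le> M - 1" using assms(2) by simp
      have "sublist (take M ?v) u \<or> sublist (rev (take M ?v)) u"
        using u(4)[OF _ sublist_take, of M] unfolding sublist_up_to_rev_def
        by (simp del: take_append)
      from rich_extend_to_prefix[OF u(1) q assms(4) tu assms(7) M this]
      obtain b where b: "rich (b @ u)" "prefix (take M ?v) (b @ u)"
        "set b \<subseteq> set u" "pals (b @ u) \<subseteq> pals u \<union> {p. M - 1 + 2 \<le> length p}"
        "length (b @ u) < 4 * length u"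
        by blast
      have "length (take M ?v) = M" using assms(3) by simp
      then have "take M (b @ u) = take M ?v"
        using b(2) by (metis append_eq_conv_conj prefixE)
      \<comment> \<open>The closures have centres of length at least \<open>M - 1\<close>, so all
        palindromes they create are longer than \<open>M\<close>.\<close>
      moreover have "short_pals M (b @ u) \<subseteq> short_pals M u"
        using b(4) assms(2) unfolding short_pals_def by auto
      ultimately show ?thesis
        using b by (intro exI[of _ "b @ u"]) (simp add: suffix_def)
    next
      assume "take M u = take M ?v \<and> (\<forall>p. palindrome p \<longrightarrow> prefix p ?v \<longrightarrow> length p \<le> M)"
      moreover have "0 < length u" using assms(6) ne by linarith
      ultimately show ?thesis using u(1) by (intro exI[of _ u]) simp
    qed
    then obtain u' where u': "rich u'" "suffix u u'" "set u' \<subseteq> set u"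
      "take M u' = take M ?v" "short_pals M u' \<subseteq> short_pals M u" "length u' < 4 * length u"
      by blast
    obtain k where k: "M = Suc k" using assms(2) by (cases M) auto
    have "take k u' = take k ?v"
      using arg_cong[OF u'(4), of "take k"] k by (simp add: min_absorb1 del: take_append)
    \<comment> \<open>Only the first \<open>M - 1\<close> letters of \<open>u'\<close> and
      \<open>?v\<close> enter here.\<close>
    then have tk: "take M (x # u') = take M (x # ?v)" by (simp add: k del: take_append)
    have tr: "prefix f (x # u')" if "prefix f (x # ?v)" "length f \<le> M" for f
      using that tk by (rule prefix_take_cong)
    have sp: "short_pals M u' \<subseteq> short_pals M ?v" using u'(5) u(5) by (rule subset_trans)
    have pu': "prefix p (x # u')" using tr p(2) True by simp
    \<comment> \<open>\<open>p\<close> is short and not in \<open>?v\<close>, and \<open>u'\<close>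
      has no short palindromes beyond those of \<open>?v\<close>.\<close>
    have np: "\<not> sublist p u'"
    proof
      assume "sublist p u'"
      then have "p \<in> short_pals M u'" using p(1) True by (simp add: short_pals_def pals_def)
      then show False using sp p(3) by (auto simp: short_pals_def pals_def)
    qed
    have 1: "rich (x # u')"
      using u'(1) p(1) pu' np by (intro rich_Cons_iff[THEN iffD2] conjI exI[of _ p])
    have 2: "suffix u0 (x # u')"
      using u(2) u'(2) suffix_order.trans suffix_ConsI by metis
    have 3: "set (x # u') \<subseteq> set (x # ?v)" using u'(3) u(3) by auto
    have 4: "sublist_up_to_rev f (x # u')" if "length f \<le> M" "sublist f (x # ?v)" for f
      using that(2) unfolding sublist_Cons_right
    proof
      assume "prefix f (x # ?v)"
      then show ?thesis using tr[OF _ that(1)] by (simp add: sublist_up_to_rev_def prefix_imp_sublist)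
    next
      assume "sublist f ?v"
      moreover have "sublist u (x # u')"
        using u'(2) by (simp add: suffix_ConsI suffix_imp_sublist)
      ultimately show ?thesis using u(4)[OF that(1)] sublist_up_to_rev_trans by metis
    qed
    have 5: "short_pals M (x # u') \<subseteq> short_pals M (x # ?v)"
      using short_pals_Cons[OF p(1) pu' np True] short_pals_Cons[OF p True] sp by auto
    \<comment> \<open>The new short palindrome \<open>p\<close> pays for the factor 4; strictness of
      the bound on \<open>u'\<close> leaves room for \<open>x\<close>.\<close>
    have 6: "length (x # u') \<le> length u0 * 4 ^ ?N (x # ?v)"
      using u'(6) u(6) card_short_pals_Cons[OF p True] by simp
    \<comment> \<open>A palindromic prefix longer than \<open>p\<close> would make \<open>p\<close>
      recur in \<open>?v\<close>. This establishes the second state for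
      \<open>x # u'\<close>.\<close>
    have 7: "length q \<le> M" if "palindrome q" "prefix q (x # ?v)" for q
    proof (rule ccontr)
      assume "\<not> length q \<le> M"
      then show False
        using shorter_palindrome_prefix_recurs[OF p(1) that(1) p(2) that(2)] p(3) True by simp
    qed
    have "rich (x # u') \<and> suffix u0 (x # u') \<and> set (x # u') \<subseteq> set ((x # a) @ u0) \<and>
      (\<forall>f. length f \<le> M \<longrightarrow> sublist f ((x # a) @ u0) \<longrightarrow> sublist_up_to_rev f (x # u')) \<and>
      short_pals M (x # u') \<subseteq> short_pals M ((x # a) @ u0) \<and>
      length (x # u') \<le> length u0 * 4 ^ ?N ((x # a) @ u0) \<and>
      take M (x # u') = take M ((x # a) @ u0) \<and>
      (\<forall>p. palindrome p \<longrightarrow> prefix p ((x # a) @ u0) \<longrightarrow> length p \<le> M)"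
      unfolding append_Cons using 1 2 3 4 5 6 7 tk by blast
    then show ?thesis by blast
  qed
qed

section \<open>Reaching a palindromic prefix of length \<open>M - 1\<close> or
  \<open>M\<close>\<close>

text \<open>While all palindromic prefixes are shorter than \<open>M - 1\<close>, every added letter
  creates a palindrome of length at most \<open>M\<close>, and only \<open>C\<close> of these are
  available.\<close>

lemma rich_extend_to_palindrome_prefix:
  assumes "rich v" "v \<noteq> []" "2 \<le> M"
    "\<And>p. palindrome p \<Longrightarrow> prefix p v \<Longrightarrow> length p \<le> M"
    "\<And>w. rich w \<Longrightarrow> set w \<subseteq> set v \<Longrightarrow> card (short_pals M w) \<le> C"
  shows "\<exists>z t. rich (z @ v) \<and> set z \<subseteq> set v \<and> length z \<le> C \<and>
    palindrome t \<and> prefix t (z @ v) \<and> M - 1 \<le> length t \<and> length t \<le> M"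
proof (rule ccontr)
  assume neg: "\<not> ?thesis"
  have "\<exists>z. length z = k \<and> rich (z @ v) \<and> set z \<subseteq> set v \<and> k \<le> card (short_pals M (z @ v)) \<and>
     (\<forall>p. palindrome p \<longrightarrow> prefix p (z @ v) \<longrightarrow> length p < M - 1)" if "k \<le> Suc C" for k
    using that
  proof (induction k)
    case 0
    have "length p < M - 1" if "palindrome p" "prefix p v" for p
    proof (rule ccontr)
      assume "\<not> length p < M - 1"
      then have "rich ([] @ v) \<and> set [] \<subseteq> set v \<and> length ([] :: 'a list) \<le> C \<and>
        palindrome p \<and> prefix p ([] @ v) \<and> M - 1 \<le> length p \<and> length p \<le> M"
        using assms(1,4) that by simp
      then show False using neg by metis
    qed
    then show ?case using assms(1) by (intro exI[of _ "[]"]) simp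
  next
    case (Suc k)
    then obtain z where z: "length z = k" "rich (z @ v)" "set z \<subseteq> set v"
      "k \<le> card (short_pals M (z @ v))"
      "\<And>p. palindrome p \<Longrightarrow> prefix p (z @ v) \<Longrightarrow> length p < M - 1"
      by (metis Suc_leD)
    have "k \<le> C" 
    proof -
      have "set (z @ v) \<subseteq> set v" using z(3) by simp
      then show ?thesis using assms(5)[OF z(2)] z(4) by linarith
    qed
    obtain x where x: "x \<in> set (z @ v)" "rich (x # z @ v)"
      using rich_extend_left[OF z(2)] assms(2) by auto
    then obtain p where p: "palindrome p" "prefix p (x # z @ v)" "\<not> sublist p (z @ v)"
      unfolding rich_Cons_iff by blast
    have xz: "set (x # z) \<subseteq> set v" using x z(3) by auto
    have plen: "length p \<le> M"
    \<comment> \<open>Stripped of its two ends, \<open>p\<close> is a palindromic prefix of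
      \<open>z @ v\<close>, hence of length at most \<open>M - 2\<close>.\<close>
    proof (cases "2 \<le> length p")
      case True
      then obtain y q where q: "p = y # q @ [y]" "palindrome q"
        using palindrome_strip[OF p(1)] by blast
      have "prefix (q @ [y]) (z @ v)" using p(2) q(1) by auto
      then have "prefix q (z @ v)" by (rule append_prefixD)
      then show ?thesis using z(5)[OF q(2)] q(1) by simp
    qed (use assms(3) in simp)
    show ?case
    \<comment> \<open>The negated claim covers only extensions by at most \<open>C\<close> letters;
      letter \<open>C + 1\<close> instead violates the bound on short palindromes.\<close>
    proof (cases "k = C")
      case True
      have "Suc C \<le> card (short_pals M (x # z @ v))"
        using card_short_pals_Cons[OF p plen] z(4) True by simp
      moreover have "set (x # z @ v) \<subseteq> set v" using xz by simp
      ultimately show ?thesis using assms(5)[OF x(2)] by simp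
    next
      case False
      have "length p < M - 1"
      proof (rule ccontr)
        assume "\<not> length p < M - 1"
        then have "rich ((x # z) @ v) \<and> set (x # z) \<subseteq> set v \<and> length (x # z) \<le> C \<and>
          palindrome p \<and> prefix p ((x # z) @ v) \<and> M - 1 \<le> length p \<and> length p \<le> M"
          using x(2) xz p plen z(1) False \<open>k \<le> C\<close> by simp
        then show False using neg by metis
      qed
      moreover have "length q \<le> length p" if "palindrome q" "prefix q (x # z @ v)" for q
        using shorter_palindrome_prefix_recurs[OF p(1) that(1) p(2) that(2)] p(3)
        by (meson not_less)
      ultimately have "\<forall>q. palindrome q \<longrightarrow> prefix q (x # z @ v) \<longrightarrow> length q < M - 1"
        by (meson le_less_trans)
      moreover have "Suc k \<le> card (short_pals M (x # z @ v))"
        using card_short_pals_Cons[OF p plen] z(4) by simp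
      ultimately show ?thesis using x(2) xz z(1) by (intro exI[of _ "x # z"]) simp
    qed
  qed
  from this[of "Suc C"] obtain z where "rich (z @ v)" "set z \<subseteq> set v"
    "Suc C \<le> card (short_pals M (z @ v))" by blast
  with assms(5)[of "z @ v"] show False by simp
qed


section \<open>Counting short palindromes\<close>

text \<open>A word and its reversal are both members, which explains the factor 2 in the bounds
  below.\<close>

definition factors_up_to_rev :: "nat \<Rightarrow> 'a list \<Rightarrow> 'a list set" where
  "factors_up_to_rev n w = {f. length f = n \<and> sublist_up_to_rev f w}"

text \<open>A letter added to the left yields a factor that is new up to reversal only if the new
  palindrome has length at most \<open>n\<close>.\<close>
lemma card_factors_up_to_rev_le:
  assumes "rich w" "1 \<le> n"
  shows "finite (factors_up_to_rev n w) \<and>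
    card (factors_up_to_rev n w) \<le> 2 * card (short_pals n w)"
  using assms(1)
proof (induction w)
  case Nil
  have "factors_up_to_rev n ([] :: 'a list) = {}"
    using assms(2) by (auto simp: factors_up_to_rev_def sublist_up_to_rev_def)
  then show ?case by simp
next
  case (Cons x v)
  then obtain p where v: "rich v"
    and p: "palindrome p" "prefix p (x # v)" "\<not> sublist p v"
    by (auto simp: rich_Cons_iff)
  note IH = Cons.IH[OF v]
  have sub: "factors_up_to_rev n (x # v) \<subseteq>
      factors_up_to_rev n v \<union> {f. length f = n \<and> (prefix f (x # v) \<or> prefix (rev f) (x # v))}"
    by (auto simp: factors_up_to_rev_def sublist_up_to_rev_def sublist_Cons_right)
  show ?case
  proof (cases "length p \<le> n")
    case True
    \<comment> \<open>Only one word and its reversal can be new, and the short palindrome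
      \<open>p\<close> accounts for both.\<close>
    have "f = take n (x # v) \<or> f = rev (take n (x # v))"
      if "length f = n" "prefix f (x # v) \<or> prefix (rev f) (x # v)" for f
      using that by (metis append_eq_conv_conj length_rev prefixE rev_rev_ident)
    then have "factors_up_to_rev n (x # v) \<subseteq>
        insert (take n (x # v)) (insert (rev (take n (x # v))) (factors_up_to_rev n v))" (is "_ \<subseteq> ?S")
      using sub by blast
    moreover have fin: "finite ?S" using IH by simp
    moreover have "card ?S \<le> card (factors_up_to_rev n v) + 2"
      using IH by (simp add: card_insert_if)
    ultimately have "finite (factors_up_to_rev n (x # v))"
      "card (factors_up_to_rev n (x # v)) \<le> card (factors_up_to_rev n v) + 2"
      by (auto intro: finite_subset dest: card_mono[rotated])
    then show ?thesis
      using IH card_short_pals_Cons[OF p True] by simp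
  next
    case False
    have "f \<in> factors_up_to_rev n v"
      if "length f = n" "prefix f (x # v) \<or> prefix (rev f) (x # v)" for f
    proof -
      have "sublist (rev f) v \<or> sublist (rev (rev f)) v"
        using prefix_of_long_new_palindrome[OF p(1,2), of f]
          prefix_of_long_new_palindrome[OF p(1,2), of "rev f"] that False by auto
      then show ?thesis
        using that by (auto simp: factors_up_to_rev_def sublist_up_to_rev_def)
    qed
    then have "factors_up_to_rev n (x # v) \<subseteq> factors_up_to_rev n v"
      using sub by blast
    moreover have "card (short_pals n v) \<le> card (short_pals n (x # v))"
      by (rule card_short_pals_mono) (simp add: suffix_ConsI suffix_imp_sublist)
    moreover have "card (factors_up_to_rev n (x # v)) \<le> card (factors_up_to_rev n v)"
      using calculation(1) IH by (simp add: card_mono)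
    ultimately show ?thesis using IH by (auto intro: finite_subset)
  qed
qed

lemma palindrome_eq_of_prefix:
  assumes "palindrome p" "palindrome q" "length p = length q"
    "take n p = take n q" "length p \<le> 2 * n"
  shows "p = q"
proof (rule nth_equalityI[OF assms(3)])
  fix i assume i: "i < length p"
  show "p ! i = q ! i"
  proof (cases "i < n")
    case True
    then show ?thesis using assms(4) by (metis nth_take)
  next
    case False
    let ?j = "length p - Suc i"
    have "?j < n" using False i assms(5) by simp
    then have "p ! ?j = q ! ?j" using assms(4) by (metis nth_take)
    moreover have "p ! i = p ! ?j"
      using assms(1) i unfolding palindrome_def by (metis rev_nth)
    moreover have "q ! i = q ! ?j"
      using assms(2,3) i unfolding palindrome_def by (metis rev_nth)
    ultimately show ?thesis by simp
  qed
qed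

text \<open>A palindrome of length \<open>k \<le> 2 * n\<close> is determined by its first
  \<open>n\<close> letters, which form a factor of length \<open>n\<close>.\<close>

lemma card_pals_of_length_le:
  assumes "rich w" "1 \<le> n" "n \<le> k" "k \<le> 2 * n"
  shows "card {p \<in> pals w. length p = k} \<le> 2 * card (short_pals n w)"
proof -
  have "inj_on (take n) {p \<in> pals w. length p = k}"
  proof (rule inj_onI)
    fix p q :: "'a list"
    assume "p \<in> {p \<in> pals w. length p = k}" "q \<in> {p \<in> pals w. length p = k}"
      and e: "take n p = take n q"
    then have "palindrome p" "palindrome q" "length p = length q" "length p \<le> 2 * n"
      using assms(4) by (auto simp: pals_def)
    then show "p = q" using e palindrome_eq_of_prefix by blast
  qed
  moreover have "take n ` {p \<in> pals w. length p = k} \<subseteq> factors_up_to_rev n w"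
  proof (rule image_subsetI)
    fix p assume "p \<in> {p \<in> pals w. length p = k}"
    then have "sublist p w" "length p = k" by (auto simp: pals_def)
    moreover have "sublist (take n p) w"
      using \<open>sublist p w\<close> sublist_take sublist_order.order_trans by metis
    ultimately show "take n p \<in> factors_up_to_rev n w"
      using assms(3) by (simp add: factors_up_to_rev_def sublist_up_to_rev_def)
  qed
  ultimately show ?thesis
    using card_factors_up_to_rev_le[OF assms(1,2)] card_inj_on_le le_trans by metis
qed

text \<open>Each of the \<open>n\<close> lengths between \<open>n + 1\<close> and
  \<open>2 * n\<close> contributes at most twice the number of palindromes of length at most
  \<open>n\<close>.\<close>

lemma card_short_pals_double:
  assumes "rich w" "1 \<le> n"
  shows "card (short_pals (2 * n) w) \<le> 4 * n * card (short_pals n w)"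
proof -
  let ?P = "\<lambda>k. {p \<in> pals w. length p = k}"
  have fin: "finite (?P k)" for k
    by (rule finite_subset[OF _ finite_pals[of w]]) auto
  have "short_pals (2 * n) w \<subseteq> short_pals n w \<union> (\<Union>k\<in>{n<..2*n}. ?P k)"
    by (auto simp: short_pals_def)
  then have "card (short_pals (2 * n) w) \<le> card (short_pals n w \<union> (\<Union>k\<in>{n<..2*n}. ?P k))"
    using finite_short_pals fin by (intro card_mono) auto
  also have "\<dots> \<le> card (short_pals n w) + card (\<Union>k\<in>{n<..2*n}. ?P k)"
    by (rule card_Un_le)
  also have "card (\<Union>k\<in>{n<..2*n}. ?P k) \<le> (\<Sum>k\<in>{n<..2*n}. card (?P k))"
    by (rule card_UN_le) simp
  also have "\<dots> \<le> (\<Sum>k\<in>{n<..2*n}. 2 * card (short_pals n w))"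
    using card_pals_of_length_le[OF assms] by (intro sum_mono) auto
  also have "\<dots> = 2 * n * card (short_pals n w)" by simp
  finally have "card (short_pals (2 * n) w) \<le> card (short_pals n w) + 2 * n * card (short_pals n w)"
    by simp
  also have "\<dots> = (2 * n + 1) * card (short_pals n w)" by simp
  also have "\<dots> \<le> 4 * n * card (short_pals n w)"
    using assms(2) by (intro mult_le_mono1) simp
  finally show ?thesis .
qed

text \<open>The empty word and the letters start the count. Doubling the length \<open>2 ^ j\<close>
  costs a factor \<open>2 ^ (j + 2)\<close>, and these exponents sum to at most
  \<open>j * (j + 1)\<close>.\<close>

lemma card_short_pals_power2_le:
  assumes "rich w"
  shows "card (short_pals (2 ^ j) w) \<le> (card (set w) + 1) * 2 ^ (j * (j + 1))"
proof (induction j)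
  case 0
  have "short_pals 1 w \<subseteq> insert [] ((\<lambda>x. [x]) ` set w)"
  proof
    fix p assume "p \<in> short_pals 1 w"
    then have p: "sublist p w" "length p \<le> 1" by (auto simp: short_pals_def pals_def)
    show "p \<in> insert [] ((\<lambda>x. [x]) ` set w)"
    proof (cases p)
      case (Cons x p')
      then have "p = [x]" using p(2) by simp
      then show ?thesis using set_mono_sublist[OF p(1)] by simp
    qed simp
  qed
  then have "card (short_pals 1 w) \<le> card (insert [] ((\<lambda>x. [x]) ` set w))"
    by (intro card_mono) auto
  also have "\<dots> \<le> Suc (card ((\<lambda>x. [x]) ` set w))" by (simp add: card_insert_if)
  also have "\<dots> \<le> card (set w) + 1" by (simp add: card_image_le)
  finally show ?case by simp
next
  case (Suc j)
  have "card (short_pals (2 ^ Suc j) w) \<le> 4 * 2 ^ j * card (short_pals (2 ^ j) w)"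
    using card_short_pals_double[OF assms, of "2 ^ j"] by simp
  also have "\<dots> \<le> 4 * 2 ^ j * ((card (set w) + 1) * 2 ^ (j * (j + 1)))"
    using Suc.IH by (rule mult_le_mono2)
  also have "\<dots> = (card (set w) + 1) * 2 ^ (j * (j + 1) + j + 2)"
    by (simp add: power_add algebra_simps)
  also have "\<dots> \<le> (card (set w) + 1) * 2 ^ (Suc j * (Suc j + 1))"
    by (intro mult_le_mono2 power_increasing) simp_all
  finally show ?case .
qed


section \<open>Assembling a short rich superword\<close>

text \<open>The full palindromic closure is a palindrome, so it contains the reversal of each of its
  factors.\<close>

lemma rich_superword_both_orientations:
  assumes "rich u"
  shows "\<exists>v. rich v \<and> set v \<subseteq> set u \<and> length v \<le> 2 * length u \<and>
    (\<forall>f. sublist_up_to_rev f u \<longrightarrow> sublist f v)"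
proof (cases "u = []")
  case True
  then show ?thesis
    using assms by (intro exI[of _ "[]"]) (auto simp: sublist_up_to_rev_def)
next
  case False
  \<comment> \<open>With \<open>n = 0\<close> the empty palindrome serves as both \<open>p\<close>
    and \<open>t\<close>.\<close>
  obtain s r where sr: "u = s @ r" "palindrome (rev r @ u)" "rich (rev r @ u)"
    using rich_palindromic_closure[OF assms palindrome_Nil _ _ palindrome_Nil, of 0] False
    by (metis append_Nil2 length_greater_0_conv list.size(3) le0 Nil_prefix Nil_suffix)
  have "sublist f (rev r @ u)" if "sublist_up_to_rev f u" for f
  proof -
    have "sublist_up_to_rev f (rev r @ u)"
      using that by (rule sublist_up_to_rev_trans) simp
    then show ?thesis
      using sr(2) unfolding sublist_up_to_rev_def palindrome_def by (metis sublist_rev)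
  qed
  moreover have "set (rev r @ u) \<subseteq> set u" "length (rev r @ u) \<le> 2 * length u"
    using sr(1) by auto
  ultimately show ?thesis using sr(3) by blast
qed

text \<open>An occurrence ending in \<open>y\<close> lies inside \<open>t\<close>, and its mirror
  image in \<open>t\<close> ends before \<open>y\<close>. This allows a shortest word to be
  trimmed.\<close>

lemma sublist_up_to_rev_butlast:
  assumes "palindrome t" "suffix t (v @ [y])" "length f < length t"
    "sublist_up_to_rev f (v @ [y])"
  shows "sublist_up_to_rev f v"
proof -
  have "sublist g v \<or> sublist (rev g) v" if "sublist g (v @ [y])" "length g < length t" for g
  proof (cases "sublist g v")
    case False
    then have "suffix g (v @ [y])"
      using that(1) by (simp add: sublist_snoc)
    then have "prefix (rev g) (y # rev v)"
      by (simp add: suffix_to_prefix)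
    moreover have "prefix t (y # rev v)"
      using assms(1,2) by (simp add: suffix_to_prefix palindrome_def)
    ultimately have "sublist g (rev v)"
      using prefix_of_long_new_palindrome[OF assms(1), of y "rev v" "rev g"] that(2) by simp
    then show ?thesis by (simp add: sublist_rev_right)
  qed simp
  from this[of f] this[of "rev f"] assms(3,4) show ?thesis
    unfolding sublist_up_to_rev_def by auto
qed

text \<open>In a shortest factor \<open>v\<close> of \<open>w\<close> containing both words up to reversal every palindromic
  suffix has length at most \<open>M\<close>, so \<open>v\<close> can be extended to the right by few letters to a word
  with a palindromic suffix of length \<open>M - 1\<close> or \<open>M\<close>.\<close>
lemma short_rich_superword:
  assumes "rich w" "sublist w1 w" "sublist w2 w"
    "length w1 \<le> M" "length w2 \<le> M" "2 \<le> M"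
    "\<And>u. rich u \<Longrightarrow> set u \<subseteq> set w \<Longrightarrow> card (short_pals M u) \<le> C"
  shows "\<exists>u. rich u \<and> set u \<subseteq> set w \<and> sublist w1 u \<and> sublist w2 u \<and>
    length u \<le> 2 * ((M + 1 + C) * 4 ^ C)"
proof -
  let ?P = "\<lambda>v. sublist v w \<and> sublist_up_to_rev w1 v \<and> sublist_up_to_rev w2 v"
  have "?P w" using assms(2,3) by (simp add: sublist_up_to_rev_def)
  then obtain v where v: "sublist v w" "sublist_up_to_rev w1 v" "sublist_up_to_rev w2 v"
    and least: "\<And>v'. ?P v' \<Longrightarrow> length v \<le> length v'"
    using ex_has_least_nat[of ?P w length] by blast
  have rv: "rich v" using assms(1) v(1) by (rule rich_sublist)
  have setv: "set v \<subseteq> set w" using v(1) by (rule set_mono_sublist)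
  have "\<exists>u. rich u \<and> set u \<subseteq> set w \<and> sublist_up_to_rev w1 u \<and> sublist_up_to_rev w2 u \<and>
    length u \<le> (M + 1 + C) * 4 ^ C"
  proof (cases "length v \<le> M + 1")
    case True
    have "(M + 1 + C) * 1 \<le> (M + 1 + C) * 4 ^ C" by (intro mult_le_mono2) simp
    then have "length v \<le> (M + 1 + C) * 4 ^ C" using True by simp
    then show ?thesis using rv setv v by blast
  next
    case False
    then have vne: "v \<noteq> []" by auto
    have short: "length t \<le> M" if "palindrome t" "suffix t v" for t
    proof (rule ccontr)
      assume "\<not> length t \<le> M"
      obtain v' y where v': "v = v' @ [y]" using vne by (cases v rule: rev_cases) auto
      have "sublist_up_to_rev w1 v'" "sublist_up_to_rev w2 v'"
        using sublist_up_to_rev_butlast[OF that(1), of v' y] that(2) v(2,3) assms(4,5)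
          \<open>\<not> length t \<le> M\<close> unfolding v' by auto
      moreover have "sublist v' w"
        using v(1) unfolding v' by (meson sublist_append_rightI sublist_order.order_trans)
      ultimately show False using least[of v'] v' by simp
    qed
    \<comment> \<open>The extension lemma works on the left, so it is applied to the reversal of
      \<open>v\<close>.\<close>
    have "\<exists>z t. rich (z @ rev v) \<and> set z \<subseteq> set (rev v) \<and> length z \<le> C \<and>
      palindrome t \<and> prefix t (z @ rev v) \<and> M - 1 \<le> length t \<and> length t \<le> M"
    proof (rule rich_extend_to_palindrome_prefix)
      show "rich (rev v)" using rv by (simp add: rich_rev)
      show "length p \<le> M" if "palindrome p" "prefix p (rev v)" for p
        using short[of p] that by (simp add: suffix_to_prefix palindrome_def)
      show "card (short_pals M u) \<le> C" if "rich u" "set u \<subseteq> set (rev v)" for u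
        using assms(7)[OF that(1)] that(2) setv by auto
    qed (use vne assms(6) in auto)
    then obtain z t where z: "rich (z @ rev v)" "set z \<subseteq> set v" "length z \<le> C"
      and t: "palindrome t" "prefix t (z @ rev v)" "M - 1 \<le> length t" "length t \<le> M"
      by auto
    define x where "x = v @ rev z"
    \<comment> \<open>\<open>M + 1\<close> letters of \<open>v\<close> are kept: as \<open>t\<close>
      has length at most \<open>M\<close>, it is then a proper suffix of \<open>u0\<close>, as the
      closures require.\<close>
    define d where "d = length v - (M + 1)"
    define u0 where "u0 = drop d v @ rev z"
    have x: "x = take d v @ u0" by (simp add: x_def u0_def)
    have rx: "rich x" using z(1) rich_rev[of x] by (simp add: x_def)
    have l0: "length u0 = M + 1 + length z" using False by (simp add: u0_def d_def)
    have "suffix t x" using t(1,2) by (simp add: x_def suffix_to_prefix palindrome_def)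
    moreover have "suffix u0 x" unfolding x by (simp add: suffix_def)
    ultimately have tu0: "suffix t u0"
      by (rule suffix_length_suffix) (use t(4) l0 in simp)
    have setx: "set x \<subseteq> set w" using z(2) setv by (auto simp: x_def)
    have "M \<le> length u0" "length t < length u0" using t(4) l0 by simp_all
    from short_factors_in_small_rich_word[OF rx[unfolded x] assms(6) this(1) t(1) tu0 this(2) t(3)]
    obtain u where u: "rich u" "set u \<subseteq> set x"
      "\<And>f. length f \<le> M \<Longrightarrow> sublist f x \<Longrightarrow> sublist_up_to_rev f u"
      "length u \<le> length u0 * 4 ^ card (short_pals M x)"
      unfolding x[symmetric] by blast
    have fac: "sublist_up_to_rev f u" if "length f \<le> M" "sublist_up_to_rev f v" for f
    proof -
      have "sublist v x" by (simp add: x_def)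
      then have "sublist_up_to_rev f x" using that(2) sublist_up_to_rev_trans by metis
      then show ?thesis
        using u(3)[of f] u(3)[of "rev f"] that(1) sublist_up_to_rev_rev[of f u]
        unfolding sublist_up_to_rev_def[of f x] by auto
    qed
    have "length u0 * 4 ^ card (short_pals M x) \<le> (M + 1 + C) * 4 ^ C"
      using assms(7)[OF rx setx] l0 z(3) by (intro mult_le_mono power_increasing) auto
    then have "length u \<le> (M + 1 + C) * 4 ^ C" using u(4) by simp
    then show ?thesis
      using u(1,2) setx fac[OF assms(4) v(2)] fac[OF assms(5) v(3)] by (intro exI[of _ u]) auto
  qed
  then obtain u where u: "rich u" "set u \<subseteq> set w" "sublist_up_to_rev w1 u" "sublist_up_to_rev w2 u"
    "length u \<le> (M + 1 + C) * 4 ^ C" by blast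
  obtain u' where "rich u'" "set u' \<subseteq> set u" "length u' \<le> 2 * length u"
    "\<And>f. sublist_up_to_rev f u \<Longrightarrow> sublist f u'"
    using rich_superword_both_orientations[OF u(1)] by blast
  then show ?thesis using u by (intro exI[of _ u']) auto
qed

section \<open>Numerical estimates\<close>

text \<open>With \<open>L = log 2 m\<close>, the base \<open>4 * q ^ 10 * m\<close> is at least
  \<open>2 powr (12 + L)\<close>. It remains to compare exponents:
  \<open>2 + (L + 1) * (L + 2) \<le> 2 * L + (12 + L) * L\<close> for
  \<open>1 \<le> L\<close>.\<close>

lemma k_exponent_ge:
  assumes "2 \<le> q" "2 \<le> m" "real j \<le> log 2 (real m) + 1"
  shows "real (3 * ((q + 1) * 2 ^ (j * (j + 1)))) \<le> k_exponent q m"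
proof -
  define L where "L = log 2 (real m)"
  have L1: "1 \<le> L" using assms(2) by (simp add: L_def le_log_iff)
  have m: "real m = 2 powr L" using assms(2) by (simp add: L_def)
  have "(2::real) ^ (j * (j + 1)) = 2 powr (real j * (real j + 1))"
    by (simp add: algebra_simps flip: powr_realpow)
  also have "\<dots> \<le> 2 powr ((L + 1) * (L + 2))"
    using assms(3) L1 by (intro powr_mono mult_mono) (auto simp: L_def)
  finally have j: "(2::real) ^ (j * (j + 1)) \<le> 2 powr ((L + 1) * (L + 2))" .
  have q: "(2::real) ^ 10 \<le> real q ^ 10"
    using assms(1) by (intro power_mono) auto
  have "(2::real) powr (12 + L) = 2 ^ 12 * real m"
    by (simp add: powr_add m)
  also have "\<dots> \<le> 4 * real q ^ 10 * real m"
    using q by (intro mult_right_mono) auto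
  finally have "(2 powr (12 + L)) powr L \<le> (4 * real q ^ 10 * real m) powr L"
    using L1 by (intro powr_mono2) auto
  then have b: "2 powr ((12 + L) * L) \<le> (4 * real q ^ 10 * real m) powr L"
    by (simp add: powr_powr)
  have "3 * (2::real) ^ (j * (j + 1)) \<le> 2 powr 2 * 2 powr ((L + 1) * (L + 2))"
    using j by (intro mult_mono) auto
  also have "\<dots> = 2 powr (2 + (L + 1) * (L + 2))" by (simp add: powr_add)
  also have "\<dots> \<le> 2 powr (2 * L + (12 + L) * L)"
    using L1 by (intro powr_mono) (auto simp: algebra_simps)
  also have "\<dots> = real m ^ 2 * 2 powr ((12 + L) * L)"
    by (simp add: powr_add m powr_power mult.commute)
  also have "\<dots> \<le> real m ^ 2 * (4 * real q ^ 10 * real m) powr L"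
    using b by (intro mult_left_mono) auto
  finally have "(real q + 1) * (3 * (2::real) ^ (j * (j + 1)))
      \<le> (real q + 1) * (real m ^ 2 * (4 * real q ^ 10 * real m) powr L)"
    by (intro mult_left_mono) auto
  then show ?thesis by (simp add: k_exponent_def L_def algebra_simps)
qed

text \<open>From \<open>m + 1 + C \<le> m * 2 ^ (C + 1)\<close> and
  \<open>4 ^ C = 2 ^ (2 * C)\<close> the powers of two multiply to \<open>2 ^ (3 * C + 2)\<close>,
  whence the factor 3 in front of \<open>C\<close>.\<close>

lemma superword_length_bound:
  assumes "1 \<le> m" "real (3 * C) \<le> k"
  shows "real (2 * ((m + 1 + C) * 4 ^ C)) \<le> real m * 2 powr (k + 2)"
proof -
  have "1 * (C + 1) \<le> m * (C + 1)" using assms(1) by (rule mult_le_mono1)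
  then have "m + 1 + C \<le> m * (C + 2)" by simp
  also have "C + 2 \<le> 2 * 2 ^ C"
    using Suc_leI[OF less_exp[of C]] by linarith
  finally have "m + 1 + C \<le> m * (2 * 2 ^ C)" by simp
  then have "2 * ((m + 1 + C) * 4 ^ C) \<le> 2 * (m * (2 * 2 ^ C) * 4 ^ C)"
    by (intro mult_le_mono) auto
  also have "\<dots> = m * 2 ^ (3 * C + 2)"
  proof -
    have "(4::nat) ^ C = 2 ^ (2 * C)" by (simp add: power_mult)
    then show ?thesis by (simp add: power_add power_mult flip: power_mult_distrib)
  qed
  finally have "real (2 * ((m + 1 + C) * 4 ^ C)) \<le> real m * 2 ^ (3 * C + 2)"
    by (metis of_nat_le_iff of_nat_mult of_nat_numeral of_nat_power)
  also have "(2::real) ^ (3 * C + 2) = 2 powr real (3 * C + 2)"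
    by (simp only: powr_realpow)
  also have "\<dots> \<le> 2 powr (k + 2)"
    using assms(2) by (intro powr_mono) auto
  finally show ?thesis by (simp add: mult_left_mono)
qed

section \<open>Degenerate alphabets and lengths, and the final bound\<close>

theorem corollary5p5:
  fixes A :: "'a set" and q m :: nat and w w1 w2 :: "'a list"
  assumes "finite A" and "q = card A" and "q \<ge> 1"
    and "w \<in> lists A" and "w1 \<in> lists A" and "w2 \<in> lists A"
    and "rich w" and "rich w1" and "rich w2"
    and "sublist w1 w" and "sublist w2 w"
    and "m = max (length w1) (length w2)" and "m \<ge> 1"
  shows "\<exists>wbar \<in> lists A. rich wbar \<and> sublist w1 wbar \<and> sublist w2 wbar \<and>
           real (length wbar) \<le> real m * 2 powr (k_exponent q m + 2)"
proof -
  have k0: "0 \<le> k_exponent q m" by (simp add: k_exponent_def)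
  have small: "real n \<le> real m * 2 powr (k_exponent q m + 2)" if "n \<le> 4 * m" for n
  proof -
    have "real n \<le> real m * 4" using that by simp
    also have "(4::real) = 2 powr 2" by simp
    also have "real m * 2 powr 2 \<le> real m * 2 powr (k_exponent q m + 2)"
      using k0 by (intro mult_left_mono powr_mono) auto
    finally show ?thesis .
  qed
  \<comment> \<open>The general estimates use \<open>2 \<le> q\<close> and \<open>2 \<le> m\<close>.
    Over one letter the longer of \<open>w1\<close> and \<open>w2\<close> contains the other; for
    \<open>m = 1\<close> their concatenation is rich.\<close>
  consider "q = 1" | "m = 1" | "2 \<le> q" "2 \<le> m" using assms(3,13) by linarith
  then show ?thesis
  proof cases
    case 1
    then obtain a where A: "A = {a}" using assms(2) by (metis card_1_singletonE)
    have rep: "u = replicate (length u) a" if "u \<in> lists A" for u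
      using that unfolding A by (intro replicate_eqI) auto
    have sub: "sublist u v" if "u \<in> lists A" "v \<in> lists A" "length u \<le> length v" for u v
    proof -
      have "v = replicate (length u + (length v - length u)) a" using rep[OF that(2)] that(3) by simp
      also have "\<dots> = u @ replicate (length v - length u) a"
        using rep[OF that(1)] by (metis replicate_add)
      finally show ?thesis by (metis sublist_append_rightI)
    qed
    show ?thesis
    proof (cases "length w1 \<le> length w2")
      case True
      then show ?thesis
        using sub[OF assms(5,6)] assms(6,9,12) small[of "length w2"]
        by (intro bexI[of _ w2]) auto
    next
      case False
      then show ?thesis
        using sub[OF assms(6,5)] assms(5,8,12) small[of "length w1"]
        by (intro bexI[of _ w1]) auto
    qed
  next
    case 2
    have short: "u = [] \<or> (\<exists>x. u = [x])" if "length u \<le> 1" for u :: "'a list"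
      using that by (cases u) auto
    have singletons: "palindrome [x]" for x :: 'a by (simp add: palindrome_def)
    have rich1: "rich [x]" for x :: 'a
      unfolding rich_Cons_iff[of x "[]"] using singletons rich_Nil by (intro conjI exI[of _ "[x]"]) auto
    have rich2: "rich [x, y]" for x y :: 'a
    proof (cases "x = y")
      case True
      then show ?thesis unfolding rich_Cons_iff[of x "[y]"] using rich1
        by (intro conjI exI[of _ "[x, x]"]) (auto simp: palindrome_def dest: sublist_length_le)
    next
      case False
      then show ?thesis unfolding rich_Cons_iff[of x "[y]"] using rich1 singletons
        by (intro conjI exI[of _ "[x]"]) (auto simp: sublist_Cons_right)
    qed
    have "length w1 \<le> 1" "length w2 \<le> 1" using 2 assms(12) by auto
    then have "rich (w1 @ w2)"
      using short[of w1] short[of w2] rich1 rich2 rich_Nil by auto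
    moreover have "length (w1 @ w2) \<le> 4 * m" using assms(12) by simp
    ultimately show ?thesis
      using assms(5,6) small[of "length (w1 @ w2)"] by (intro bexI[of _ "w1 @ w2"]) auto
  next
    case 3
    \<comment> \<open>Rounding up gives \<open>m \<le> 2 ^ j\<close> at the cost of at most 1 in the
      exponent.\<close>
    define j where "j = nat \<lceil>log 2 (real m)\<rceil>"
    define C where "C = (q + 1) * 2 ^ (j * (j + 1))"
    have L0: "0 \<le> log 2 (real m)" using 3 by simp
    have jL: "log 2 (real m) \<le> real j" "real j \<le> log 2 (real m) + 1"
      using L0 unfolding j_def by linarith+
    have "real m \<le> 2 ^ j"
      using jL(1) 3 by (simp add: log_le_iff powr_realpow)
    then have mj: "m \<le> 2 ^ j" by (metis of_nat_le_iff of_nat_numeral of_nat_power)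
    have "set w \<subseteq> A" using assms(4) by auto
    have bound: "card (short_pals m u) \<le> C" if "rich u" "set u \<subseteq> set w" for u
    proof -
      have "card (short_pals m u) \<le> card (short_pals (2 ^ j) u)"
        using mj by (intro card_mono finite_short_pals) (auto simp: short_pals_def)
      also have "\<dots> \<le> (card (set u) + 1) * 2 ^ (j * (j + 1))"
        by (rule card_short_pals_power2_le[OF that(1)])
      also have "\<dots> \<le> C"
        using that(2) \<open>set w \<subseteq> A\<close> assms(1,2) unfolding C_def
        by (intro mult_le_mono1 add_le_mono1) (auto intro: card_mono)
      finally show ?thesis .
    qed
    have "length w1 \<le> m" "length w2 \<le> m" using assms(12) by auto
    from short_rich_superword[OF assms(7,10,11) this 3(2) bound]
    obtain u where u: "rich u" "set u \<subseteq> set w" "sublist w1 u" "sublist w2 u"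
      "length u \<le> 2 * ((m + 1 + C) * 4 ^ C)" by blast
    have "real (length u) \<le> real (2 * ((m + 1 + C) * 4 ^ C))"
      using u(5) by (simp only: of_nat_le_iff)
    also have "\<dots> \<le> real m * 2 powr (k_exponent q m + 2)"
      using k_exponent_ge[OF 3 jL(2)] unfolding C_def[symmetric]
      by (rule superword_length_bound[OF assms(13)])
    finally show ?thesis
      using u \<open>set w \<subseteq> A\<close> by (intro bexI[of _ u]) auto
  qed
qed

end
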